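(* Assume $\|\partial_0 f\|<1$, and let $R$, $D_a(0)$ and the sets $N_p$ ($p\in\mathbb{N}$) be as defined in the context. Then: (a) for any $p\geq 0$, $N_p\subset N_{p+1}$; (b) for any $p\geq 0$, the set $N_p$ is invariant to $f$, i.e. $f(N_p)\subset N_p$; (c) for any $x\in D_a(0)$ there exists $p^x\geq 0$ such that $x\in N_{p^x}$.
   Context: Let $\Omega\subset\mathbb{R}^n$ be a domain (open connected set) with $0\in\Omega$, and let $f:\Omega\to\Omega$ be an $\mathbb{R}$-analytic function with $f(0)=0$. Write $f^k$ for the $k$-th iterate of $f$ ($f^0=\mathrm{id}$), $\|\cdot\|$ for the Euclidean norm on $\mathbb{R}^n$ and for the induced operator norm on matrices, $\partial_0 f$ for the Jacobian matrix of $f$ at $0$, and $B(r)=\{x\in\mathbb{R}^n:\|x\|<r\}$ for $r>0$. Here $\mathbb{N}=\{0,1,2,\dots\}$. The domain of attraction of $0$ is $D_a(0)=\{x\in\Omega: f^k(x)\to 0 \text{ as } k\to\infty\}$. Standing assumption: $\|\partial_0 f\|<1$; under this assumption there is $r>0$ with $B(r)\subset\Omega$ and $\|f(x)\|<\|x\|$ for all $x\in B(r)\setminus\{0\}$. Let $R>0$ be the largest number such that $B(R)\subset\Omega$ and $\|f(x)\|<\|x\|$ for any $x\in B(R)\setminus\{0\}$; if every $r>0$ has this property, then $R=+\infty$ and $B(R)=\Omega=\mathbb{R}^n$. For an integer $p\ge 0$ and $x\in\Omega$ put $V_p(x)=\sum_{k=0}^{p}\|f^k(x)\|^2$, and $N_p=\{x\in\Omega: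 V_p(x)<(p+1)R^2\}$, with $N_p=\Omega$ if $R=+\infty$. *)

theory Defs
  imports "HOL-Analysis.Analysis"
begin

(* Multivariate real analyticity: near each point of S, f is the sum of a power series in the
   coordinates, indexed by the multi-indices \<alpha> :: 'n \<Rightarrow> nat. "has_sum" is unconditional
   convergence, which in finite dimension is absolute convergence. Since the ball is required to
   lie in S, values of f outside S play no role. *)
definition real_analytic_on :: "(real ^ 'n \<Rightarrow> real ^ 'm) \<Rightarrow> (real ^ 'n) set \<Rightarrow> bool"
    (infixl "real'_analytic'_on" 50) where
  "f real_analytic_on S \<longleftrightarrow>
     (\<forall>a\<in>S. \<exists>r>0. \<exists>c :: ('n \<Rightarrow> nat) \<Rightarrow> real ^ 'm. ball a r \<subseteq> S \<and>
        (\<forall>x\<in>ball a r.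
           ((\<lambda>\<alpha>. (\<Prod>i\<in>UNIV. (x $ i - a $ i) ^ \<alpha> i) *\<^sub>R c \<alpha>) has_sum f x) UNIV))"

definition operator_norm :: "real ^ 'n ^ 'm \<Rightarrow> real" where
  "operator_norm A = onorm (\<lambda>v. A *v v)"

definition attraction_domain ::
    "(real ^ 'n) set \<Rightarrow> (real ^ 'n \<Rightarrow> real ^ 'n) \<Rightarrow> (real ^ 'n) set" where
  "attraction_domain \<Omega> f = {x \<in> \<Omega>. (\<lambda>k. (f ^^ k) x) \<longlonglongrightarrow> 0}"

definition decreasing_radius ::
    "(real ^ 'n) set \<Rightarrow> (real ^ 'n \<Rightarrow> real ^ 'n) \<Rightarrow> real \<Rightarrow> bool" where
  "decreasing_radius \<Omega> f r \<longleftrightarrow>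
     r > 0 \<and> ball 0 r \<subseteq> \<Omega> \<and> (\<forall>x \<in> ball 0 r - {0}. norm (f x) < norm x)"

(* The number R. In the finite case the largest decreasing radius exists as soon as there is any
   decreasing radius, because the union of the balls of decreasing radius is again such a ball. *)
definition max_radius :: "(real ^ 'n) set \<Rightarrow> (real ^ 'n \<Rightarrow> real ^ 'n) \<Rightarrow> ereal" where
  "max_radius \<Omega> f =
     (if \<forall>r>0. decreasing_radius \<Omega> f r then \<infinity>
      else ereal (GREATEST r. decreasing_radius \<Omega> f r))"

definition V :: "(real ^ 'n \<Rightarrow> real ^ 'n) \<Rightarrow> nat \<Rightarrow> real ^ 'n \<Rightarrow> real" where
  "V f p x = (\<Sum>k=0..p. (norm ((f ^^ k) x))\<^sup>2)"

definition N_set ::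
    "(real ^ 'n) set \<Rightarrow> (real ^ 'n \<Rightarrow> real ^ 'n) \<Rightarrow> nat \<Rightarrow> (real ^ 'n) set" where
  "N_set \<Omega> f p =
     (if max_radius \<Omega> f = \<infinity> then \<Omega>
      else {x \<in> \<Omega>. ereal (V f p x) < ereal (real p + 1) * (max_radius \<Omega> f)\<^sup>2})"

end

theory Submission
  imports Defs
begin

text \<open>
  If \<open>R\<close> is infinite, all the sets \<open>N_set \<Omega> f p\<close> equal \<open>\<Omega>\<close>. Otherwise \<open>V f p x < (p + 1) R\<^sup>2\<close> says
  that the mean of the \<open>p + 1\<close> numbers \<open>\<parallel>f\<^sup>k x\<parallel>\<^sup>2\<close>, \<open>k \<le> p\<close>, is below \<open>R\<^sup>2\<close>, so the orbit of \<open>x\<close> has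
  entered the ball of radius \<open>R\<close> by time \<open>p\<close>. From then on the norm cannot increase along the orbit,
  whence \<open>\<parallel>f\<^sup>p\<^sup>+\<^sup>1 x\<parallel> < R\<close> (\<open>V_small_imp_iterate_in_ball\<close>).

  Passing from \<open>p\<close> to \<open>p + 1\<close> adds this one term, smaller than \<open>R\<^sup>2\<close>; that is (a). Passing from \<open>x\<close>
  to \<open>f x\<close> replaces \<open>\<parallel>x\<parallel>\<^sup>2\<close> by \<open>\<parallel>f\<^sup>p\<^sup>+\<^sup>1 x\<parallel>\<^sup>2\<close>. This cannot increase the sum: if \<open>\<parallel>x\<parallel> \<ge> R\<close>, the new
  term is smaller than the old one because it is below \<open>R\<^sup>2\<close>, and if \<open>\<parallel>x\<parallel> < R\<close>, because the whole
  orbit has nonincreasing norm; that is (b). If the orbit of \<open>x\<close> tends to \<open>0\<close>, its terms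
  \<open>\<parallel>f\<^sup>k x\<parallel>\<^sup>2\<close> are eventually below \<open>R\<^sup>2 / 2\<close>, and then \<open>(p + 1) R\<^sup>2\<close> outgrows \<open>V f p x\<close>; that is (c).

  All this needs \<open>R\<close> to be a radius of decrease itself. The supremum of the radii of decrease is
  one, since the ball of that radius is the union of the smaller ones, but at least one such radius
  has to exist. This is where \<open>\<parallel>\<partial>\<^sub>0 f\<parallel> < 1\<close> enters: analyticity makes \<open>f\<close> differentiable at \<open>0\<close>
  (\<open>real_analytic_imp_differentiable\<close>), so the jacobian is the derivative, and \<open>f\<close> contracts norms
  near \<open>0\<close>.
\<close>

section \<open>Real analytic maps are differentiable\<close>

lemma abs_summable_on_cart:
  fixes g :: "'a \<Rightarrow> real ^ 'm"
  assumes "g summable_on A"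
  shows "(\<lambda>x. norm (g x)) summable_on A"
proof -
  have comp: "(\<lambda>x. \<bar>g x $ j\<bar>) summable_on A" for j
    using summable_on_bounded_linear[OF bounded_linear_vec_nth assms]
    by (simp add: summable_on_iff_abs_summable_on_real[symmetric] flip: real_norm_def)
  have "(\<lambda>x. \<Sum>j\<in>J. \<bar>g x $ j\<bar>) summable_on A" if "finite J" for J
    using that by induction (auto intro!: summable_on_add comp)
  then have "(\<lambda>x. \<Sum>j\<in>UNIV. \<bar>g x $ j\<bar>) summable_on A"
    by simp
  then show ?thesis
    by (rule Infinite_Sum.abs_summable_on_comparison_test') (rule norm_le_l1_cart)
qed

lemma has_derivative_zero_if_quadratically_small:
  fixes g :: "'a::real_normed_vector \<Rightarrow> 'b::real_normed_vector"
  assumes "t > 0" and small: "\<And>x. x \<in> ball a t \<Longrightarrow> norm (g x) \<le> C * (norm (x - a))\<^sup>2"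
  shows "(g has_derivative (\<lambda>_. 0)) (at a)"
proof (rule has_derivativeI_sandwich[where H = "\<lambda>y. C * norm (y - a)"])
  have "g a = 0"
    using small[of a] \<open>t > 0\<close> by simp
  then show "norm (g y - g a - 0) / norm (y - a) \<le> C * norm (y - a)"
    if "y \<noteq> a" "dist y a < t" for y
    using small[of y] that by (simp add: dist_commute divide_simps power2_eq_square mult.assoc)
  show "((\<lambda>y. C * norm (y - a)) \<longlongrightarrow> 0) (at a)"
    by (auto intro!: tendsto_eq_intros)
qed (use \<open>t > 0\<close> in auto)

lemma finite_multi_indices_of_degree_le:
  "finite {\<alpha> :: 'n::finite \<Rightarrow> nat. sum \<alpha> UNIV \<le> d}"
proof (rule finite_subset)
  show "{\<alpha> :: 'n \<Rightarrow> nat. sum \<alpha> UNIV \<le> d} \<subseteq> PiE UNIV (\<lambda>_. {..d})"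
  proof (intro subsetI PiE_I)
    fix \<alpha> :: "'n \<Rightarrow> nat" and i
    assume "\<alpha> \<in> {\<alpha>. sum \<alpha> UNIV \<le> d}"
    moreover have "\<alpha> i \<le> sum \<alpha> UNIV"
      by (rule member_le_sum) auto
    ultimately show "\<alpha> i \<in> {..d}"
      by simp
  qed simp
qed (auto intro: finite_PiE)

text \<open>
  The series converges absolutely at \<open>a + (t, \<dots>, t)\<close> for some \<open>t > 0\<close>, say with sum \<open>M\<close> of norms.
  For \<open>\<parallel>x - a\<parallel> < t\<close> each monomial of degree \<open>m \<ge> 2\<close> shrinks by \<open>(\<parallel>x - a\<parallel> / t)\<^sup>m \<le> (\<parallel>x - a\<parallel> / t)\<^sup>2\<close>
  or better, so \<open>f\<close> differs from the degree-one part of the series by at most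
  \<open>M (\<parallel>x - a\<parallel> / t)\<^sup>2\<close>.
\<close>
lemma real_analytic_imp_differentiable:
  fixes f :: "real ^ 'n \<Rightarrow> real ^ 'm"
  assumes "f real_analytic_on S" and "a \<in> S"
  shows "f differentiable (at a)"
proof -
  define h where "h c x \<alpha> = (\<Prod>i\<in>UNIV. (x $ i - a $ i) ^ \<alpha> i) *\<^sub>R c \<alpha>"
    for c :: "('n \<Rightarrow> nat) \<Rightarrow> real ^ 'm" and x :: "real ^ 'n" and \<alpha>
  obtain r c where "r > 0" and series: "\<And>x. x \<in> ball a r \<Longrightarrow> (h c x has_sum f x) UNIV"
    using assms unfolding real_analytic_on_def h_def by meson
  define t where "t = r / (2 * real CARD('n))"
  define y :: "real ^ 'n" where "y = a + (\<chi> i. t)"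
  have "t > 0"
    using \<open>r > 0\<close> by (simp add: t_def)
  have "norm (y - a) \<le> (\<Sum>i\<in>UNIV. \<bar>(y - a) $ i\<bar>)"
    by (rule norm_le_l1_cart)
  also have "\<dots> = r / 2"
    using \<open>r > 0\<close> by (simp add: y_def t_def)
  finally have "y \<in> ball a r"
    using \<open>r > 0\<close> by (simp add: dist_norm norm_minus_commute)
  have "t \<le> r"
  proof -
    have "1 \<le> 2 * real CARD('n)"
      using one_le_card_finite[where 'a = 'n] by linarith
    then have "r / (2 * real CARD('n)) \<le> r / 1"
      using \<open>r > 0\<close> by (intro divide_left_mono) auto
    then show ?thesis
      by (simp add: t_def)
  qed
  define F where "F = {\<alpha> :: 'n \<Rightarrow> nat. sum \<alpha> UNIV \<le> 1}"
  define P where "P x = (\<Sum>\<alpha>\<in>F. h c x \<alpha>)" for x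
  define M where "M = (\<Sum>\<^sub>\<infinity>\<alpha>\<in>UNIV - F. norm (h c y \<alpha>))"
  have "finite F"
    unfolding F_def by (rule finite_multi_indices_of_degree_le)
  have "(\<lambda>\<alpha>. norm (h c y \<alpha>)) summable_on UNIV"
    using abs_summable_on_cart series[OF \<open>y \<in> ball a r\<close>] summable_on_def by blast
  then have "(\<lambda>\<alpha>. norm (h c y \<alpha>)) summable_on (UNIV - F)"
    by (rule summable_on_subset_banach) simp
  then have M: "((\<lambda>\<alpha>. norm (h c y \<alpha>)) has_sum M) (UNIV - F)"
    unfolding M_def by simp
  have remainder: "norm (f x - P x) \<le> M / t\<^sup>2 * (norm (x - a))\<^sup>2" if x: "x \<in> ball a t" for x
  proof -
    define q where "q = norm (x - a) / t"
    have q: "0 \<le> q" "q \<le> 1" "norm (x - a) = t * q"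
      using x \<open>t > 0\<close> by (auto simp: q_def dist_norm norm_minus_commute)
    have "x \<in> ball a r"
      using x \<open>t \<le> r\<close> by auto
    then have "(h c x has_sum (f x - P x)) (UNIV - F)"
      unfolding P_def using \<open>finite F\<close> by (intro has_sum_Diff series has_sum_finite) auto
    moreover have "((\<lambda>\<alpha>. q\<^sup>2 * norm (h c y \<alpha>)) has_sum (q\<^sup>2 * M)) (UNIV - F)"
      by (intro has_sum_cmult_right M)
    moreover have "norm (h c x \<alpha>) \<le> q\<^sup>2 * norm (h c y \<alpha>)" if "\<alpha> \<in> UNIV - F" for \<alpha>
    proof -
      let ?m = "sum \<alpha> UNIV"
      have "?m \<ge> 2"
        using that by (simp add: F_def)
      have "\<bar>\<Prod>i\<in>UNIV. (x $ i - a $ i) ^ \<alpha> i\<bar> = (\<Prod>i\<in>UNIV. \<bar>(x - a) $ i\<bar> ^ \<alpha> i)"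
        by (simp add: abs_prod power_abs)
      also have "\<dots> \<le> (\<Prod>i\<in>UNIV. norm (x - a) ^ \<alpha> i)"
        by (intro prod_mono conjI power_mono component_le_norm_cart) auto
      also have "\<dots> = t ^ ?m * q ^ ?m"
        by (simp add: q(3) power_mult_distrib power_sum prod.distrib)
      also have "\<dots> \<le> t ^ ?m * q\<^sup>2"
        using q \<open>?m \<ge> 2\<close> \<open>t > 0\<close> by (intro mult_left_mono power_decreasing) auto
      finally have "\<bar>\<Prod>i\<in>UNIV. (x $ i - a $ i) ^ \<alpha> i\<bar> * norm (c \<alpha>) \<le> t ^ ?m * q\<^sup>2 * norm (c \<alpha>)"
        by (rule mult_right_mono) simp
      then show ?thesis
        using \<open>t > 0\<close> by (simp add: h_def y_def power_sum mult_ac abs_prod)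
    qed
    ultimately have "norm (f x - P x) \<le> q\<^sup>2 * M"
      by (rule norm_infsum_le)
    then show ?thesis
      by (simp add: q_def power_divide mult.commute)
  qed
  have "((\<lambda>x. f x - P x) has_derivative (\<lambda>_. 0)) (at a)"
    using \<open>t > 0\<close> remainder by (rule has_derivative_zero_if_quadratically_small)
  then have "(\<lambda>x. f x - P x) differentiable (at a)"
    by (rule differentiableI)
  moreover have "P differentiable (at a)"
  proof -
    have coord: "((\<lambda>x :: real ^ 'n. x $ i - a $ i) has_derivative (\<lambda>x. x $ i)) (at a)" for i
      by (auto intro!: derivative_eq_intros bounded_linear_imp_has_derivative bounded_linear_vec_nth)
    have "\<exists>D. ((\<lambda>x. h c x \<alpha>) has_derivative D) (at a)" for \<alpha>
      unfolding h_def
      by (rule exI, rule has_derivative_scaleR_left, rule has_derivative_prod,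
          rule has_derivative_power, rule coord)
    then show ?thesis
      unfolding P_def using \<open>finite F\<close> by (intro differentiable_sum) (auto simp: differentiable_def)
  qed
  ultimately have "(\<lambda>x. (f x - P x) + P x) differentiable (at a)"
    by (rule differentiable_add)
  then show ?thesis
    by simp
qed


section \<open>The radius of decrease\<close>

lemma decreasing_radius_exists:
  fixes \<Omega> :: "(real ^ 'n) set"
  assumes "open \<Omega>" and "0 \<in> \<Omega>" and "f differentiable (at 0)" and "f 0 = 0"
    and contr: "operator_norm (jacobian f (at 0)) < 1"
  shows "\<exists>r. decreasing_radius \<Omega> f r"
proof -
  define L where "L = (\<lambda>v. jacobian f (at 0) *v v)"
  define e where "e = (1 - onorm L) / 2"
  have L: "(f has_derivative L) (at 0)"
    using assms(3) by (simp add: L_def jacobian_works)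
  have e: "e > 0" "onorm L + e < 1"
    using contr by (auto simp: e_def L_def operator_norm_def field_simps)
  obtain d where "d > 0" and d: "\<And>x. norm x < d \<Longrightarrow> norm (f x - L x) \<le> e * norm x"
    using L e \<open>f 0 = 0\<close> unfolding has_derivative_at_alt by force
  obtain s where "s > 0" "ball 0 s \<subseteq> \<Omega>"
    using assms(1,2) openE by blast
  have "norm (f x) < norm x" if "norm x < d" "x \<noteq> 0" for x
  proof -
    have "norm (f x) \<le> norm (L x) + norm (f x - L x)"
      by norm
    also have "\<dots> \<le> (onorm L + e) * norm x"
      using onorm[OF has_derivative_bounded_linear[OF L], of x] d[OF that(1)]
      by (simp add: algebra_simps)
    also have "\<dots> < norm x"
      using e that(2) by simp
    finally show ?thesis .
  qed
  then have "decreasing_radius \<Omega> f (min d s)"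
    using \<open>d > 0\<close> \<open>s > 0\<close> \<open>ball 0 s \<subseteq> \<Omega>\<close> by (auto simp: decreasing_radius_def)
  then show ?thesis ..
qed

lemma decreasing_radius_mono:
  assumes "decreasing_radius \<Omega> f r" "0 < s" "s \<le> r"
  shows "decreasing_radius \<Omega> f s"
  using assms by (auto simp: decreasing_radius_def)

text \<open>
  The radii of decrease form an interval with left end \<open>0\<close>. When it is bounded it contains its
  supremum, because every point of the ball of that radius lies in the ball of a smaller one.
\<close>
lemma max_radius_cases:
  fixes \<Omega> :: "(real ^ 'n) set"
  assumes "\<exists>r. decreasing_radius \<Omega> f r"
  obtains "max_radius \<Omega> f = \<infinity>"
  | R where "max_radius \<Omega> f = ereal R" "decreasing_radius \<Omega> f R"
proof (cases "\<forall>r>0. decreasing_radius \<Omega> f r")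
  case True
  then show ?thesis
    using that(1) by (simp add: max_radius_def)
next
  case False
  define D where "D = Collect (decreasing_radius \<Omega> f)"
  define R where "R = Sup D"
  from False obtain b where "b > 0" "\<not> decreasing_radius \<Omega> f b"
    by blast
  then have "r \<le> b" if "r \<in> D" for r
    using that decreasing_radius_mono[of \<Omega> f r b] by (force simp: D_def)
  then have bdd: "bdd_above D"
    by (rule bdd_aboveI)
  have ne: "D \<noteq> {}"
    using assms by (simp add: D_def)
  have le: "r \<le> R" if "decreasing_radius \<Omega> f r" for r
    unfolding R_def using that bdd by (simp add: D_def cSup_upper)
  have inner: "\<exists>r. decreasing_radius \<Omega> f r \<and> x \<in> ball 0 r" if "x \<in> ball 0 R" for x :: "real ^ 'n"
    using that less_cSup_iff[OF ne bdd, of "norm x"] by (auto simp: R_def D_def)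
  have R: "decreasing_radius \<Omega> f R"
    unfolding decreasing_radius_def
  proof (intro conjI ballI subsetI)
    show "R > 0"
      using assms le by (force simp: decreasing_radius_def)
    show "x \<in> \<Omega>" if "x \<in> ball 0 R" for x
      using inner[OF that] by (auto simp: decreasing_radius_def)
    show "norm (f x) < norm x" if "x \<in> ball 0 R - {0}" for x
      using inner[of x] that by (auto simp: decreasing_radius_def)
  qed
  have "(GREATEST r. decreasing_radius \<Omega> f r) = R"
    using R le by (rule Greatest_equality)
  then show ?thesis
    using False R that(2) by (simp add: max_radius_def)
qed


section \<open>Sums of squared norms along an orbit\<close>

lemma decreasing_radius_iterate_le:
  assumes dec: "decreasing_radius \<Omega> f R" and "f 0 = 0" and "norm x < R"
  shows "norm ((f ^^ k) x) \<le> norm x"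
proof (induction k)
  case (Suc k)
  have "norm (f z) \<le> norm z" if "norm z < R" for z
    using dec \<open>f 0 = 0\<close> that by (cases "z = 0") (auto simp: decreasing_radius_def intro: less_imp_le)
  then have "norm (f ((f ^^ k) x)) \<le> norm ((f ^^ k) x)"
    using Suc.IH \<open>norm x < R\<close> by simp
  with Suc.IH show ?case
    by simp
qed simp

text \<open>
  A sum of \<open>p + 1\<close> terms below \<open>(p + 1) R\<^sup>2\<close> has a term below \<open>R\<^sup>2\<close>, so the orbit meets the ball of
  radius \<open>R\<close>, which it never leaves again.
\<close>
lemma V_small_imp_iterate_in_ball:
  assumes dec: "decreasing_radius \<Omega> f R" and "f 0 = 0" and V: "V f p x < (real p + 1) * R\<^sup>2"
  shows "norm ((f ^^ Suc p) x) < R"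
proof -
  have "R > 0"
    using dec by (simp add: decreasing_radius_def)
  have "\<exists>k\<le>p. norm ((f ^^ k) x) < R"
  proof (rule ccontr)
    assume "\<not> ?thesis"
    then have "(\<Sum>k=0..p. R\<^sup>2) \<le> V f p x"
      unfolding V_def using \<open>R > 0\<close> by (intro sum_mono power_mono) auto
    with V show False
      by (simp add: algebra_simps)
  qed
  then obtain k where k: "k \<le> p" "norm ((f ^^ k) x) < R"
    by blast
  have "(f ^^ Suc p) x = (f ^^ (Suc p - k)) ((f ^^ k) x)"
    using k(1) by (simp flip: funpow_add o_apply[of "f ^^ _" "f ^^ _"] del: funpow.simps)
  then show ?thesis
    using decreasing_radius_iterate_le[OF dec \<open>f 0 = 0\<close> k(2), of "Suc p - k"] k(2)
    by (simp del: funpow.simps)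
qed

lemma V_Suc: "V f (Suc p) x = V f p x + (norm ((f ^^ Suc p) x))\<^sup>2"
  by (simp add: V_def)

lemma V_image: "V f p (f x) = V f p x - (norm x)\<^sup>2 + (norm ((f ^^ Suc p) x))\<^sup>2"
proof (induction p)
  case (Suc p)
  then show ?case
    unfolding V_Suc by (simp add: funpow_swap1)
qed (simp add: V_def)

lemma V_image_le:
  assumes dec: "decreasing_radius \<Omega> f R" and "f 0 = 0" and V: "V f p x < (real p + 1) * R\<^sup>2"
  shows "V f p (f x) \<le> V f p x"
proof -
  have "norm ((f ^^ Suc p) x) \<le> norm x"
    using V_small_imp_iterate_in_ball[OF assms] decreasing_radius_iterate_le[OF dec \<open>f 0 = 0\<close>, of x "Suc p"]
    by linarith
  then show ?thesis
    by (simp add: V_image del: funpow.simps)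
qed

text \<open>
  Past a time \<open>K\<close> after which the squared norms stay below \<open>c\<close>, the sum grows by at most \<open>c\<close> per step,
  while the bound grows by \<open>2 c\<close> per step and thus makes up for the first \<open>K\<close> terms.
\<close>
lemma V_eventually_small:
  fixes f :: "real ^ 'n \<Rightarrow> real ^ 'n"
  assumes lim: "(\<lambda>k. (f ^^ k) x) \<longlonglongrightarrow> 0" and "c > 0"
  shows "\<exists>p. V f p x < (real p + 1) * (2 * c)"
proof -
  have "(\<lambda>k. (norm ((f ^^ k) x))\<^sup>2) \<longlonglongrightarrow> 0"
    using tendsto_power[OF tendsto_norm[OF lim], of 2] by simp
  then obtain K where K: "\<And>k. k \<ge> K \<Longrightarrow> (norm ((f ^^ k) x))\<^sup>2 < c"
    using order_tendstoD(2) \<open>c > 0\<close> by (fastforce simp: eventually_sequentially)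
  have bound: "V f (K + j) x \<le> V f K x + real j * c" for j
  proof (induction j)
    case (Suc j)
    then show ?case
      using K[of "Suc (K + j)"] by (simp add: V_Suc algebra_simps del: funpow.simps)
  qed simp
  obtain j where "V f K x < real j * c"
    using reals_Archimedean3[OF \<open>c > 0\<close>] by blast
  with bound[of j] have "V f (K + j) x < real j * (2 * c)"
    by linarith
  also have "\<dots> \<le> (real (K + j) + 1) * (2 * c)"
    using \<open>c > 0\<close> by (intro mult_right_mono) auto
  finally show ?thesis ..
qed


section \<open>Sublevel sets exhausting the domain of attraction\<close>

theorem theorem2p8:
  fixes \<Omega> :: "(real ^ 'n) set" and f :: "real ^ 'n \<Rightarrow> real ^ 'n"
  assumes "open \<Omega>" and "connected \<Omega>" and "0 \<in> \<Omega>"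
    and "f ` \<Omega> \<subseteq> \<Omega>"
    and "f real_analytic_on \<Omega>"
    and "f 0 = 0"
    and "operator_norm (jacobian f (at 0)) < 1"
  shows "(\<forall>p. N_set \<Omega> f p \<subseteq> N_set \<Omega> f (p + 1)) \<and>
         (\<forall>p. f ` N_set \<Omega> f p \<subseteq> N_set \<Omega> f p) \<and>
         (\<forall>x \<in> attraction_domain \<Omega> f. \<exists>p. x \<in> N_set \<Omega> f p)"
proof -
  have "f differentiable (at 0)"
    using assms(5,3) by (rule real_analytic_imp_differentiable)
  then have "\<exists>r. decreasing_radius \<Omega> f r"
    using assms by (intro decreasing_radius_exists)
  then show ?thesis
  proof (cases rule: max_radius_cases)
    case 1
    then have "N_set \<Omega> f p = \<Omega>" for p
      by (simp add: N_set_def)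
    then show ?thesis
      using assms(4) by (auto simp: attraction_domain_def)
  next
    case (2 R)
    note dec = \<open>decreasing_radius \<Omega> f R\<close>
    have "R > 0"
      using dec by (simp add: decreasing_radius_def)
    have N: "N_set \<Omega> f p = {x \<in> \<Omega>. V f p x < (real p + 1) * R\<^sup>2}" for p
      using 2 by (simp add: N_set_def power2_eq_square)
    have "N_set \<Omega> f p \<subseteq> N_set \<Omega> f (p + 1)" for p
    proof
      fix x assume "x \<in> N_set \<Omega> f p"
      then have x: "x \<in> \<Omega>" "V f p x < (real p + 1) * R\<^sup>2"
        by (auto simp: N)
      have "(norm ((f ^^ Suc p) x))\<^sup>2 < R\<^sup>2"
        using V_small_imp_iterate_in_ball[OF dec assms(6) x(2)] by (intro power_strict_mono) auto
      with x show "x \<in> N_set \<Omega> f (p + 1)"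
        by (simp add: N V_Suc algebra_simps del: funpow.simps)
    qed
    moreover have "f ` N_set \<Omega> f p \<subseteq> N_set \<Omega> f p" for p
      using V_image_le[OF dec assms(6)] assms(4) by (force simp: N)
    moreover have "\<exists>p. x \<in> N_set \<Omega> f p" if "x \<in> attraction_domain \<Omega> f" for x
      using that V_eventually_small[of f x "R\<^sup>2 / 2"] \<open>R > 0\<close> by (auto simp: N attraction_domain_def)
    ultimately show ?thesis
      by blast
  qed
qed

end
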